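(* Let $A$ be a finite commutative ring with identity, $\sigma$ a ring automorphism of $A$, $a\in U(A)$, and $\mathcal{C}=(g(X))_{n,\sigma}^a$ a principal $\sigma$-constacyclic code of length $n$, where $g(X)\in A[X;\sigma]$ is monic of degree $n-k$, is a right divisor of $X^n-a$, and is also a left divisor of $X^n-a$ with $X^n-a=g(X)h(X)$ for some $h(X)=\sum_{i=0}^k h_iX^i\in A[X;\sigma]$. Then a parity-check matrix $H_*\in M_{n-k,n}(A)$ of $\mathcal{C}$ is given by $$\left( \begin{array}{ccccccccc} h_{k} & \sigma(h_{k-1}) & \sigma^2(h_{k-2})& \dots & \sigma^k(h_0) & 0 & 0 & \dots & 0\\ 0 & \sigma(h_{k}) & \sigma^2(h_{k-1}) & \dots & \sigma^k(h_1) & \sigma^{k+1}(h_0) & 0 & \dots & 0\\ \dots & \dots & \dots & \dots & \dots & \dots & \dots & \dots & \dots \\ 0 & 0 & 0 & \dots & \dots & \sigma^{n-k-1}(h_k) & \dots & \dots & \sigma^{n-1}(h_0) \end{array} \right),$$ i.e. for $0\le t\le n-k-1$, row $t$ consists of $t$ zeros, followed by $\sigma^t(h_k),\sigma^{t+1}(h_{k-1}),\dots,\sigma^{t+k}(h_0)$, followed by zeros.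
   Context: $U(A)$ is the group of units of $A$. $A[X;\sigma]$ is the skew-polynomial ring of elements $\sum a_iX^i$ with multiplication determined by $Xa=\sigma(a)X$; $(p)_l$ is the left ideal generated by $p$. For $a\in U(A)$ and $g$ a right divisor of $X^n-a$, the principal $\sigma$-constacyclic code $(g(X))_{n,\sigma}^a$ is the set of $(d_0,\dots,d_{n-1})\in A^n$ with $\sum_{i=0}^{n-1}d_iX^i+(X^n-a)_l\in(g)_l/(X^n-a)_l$; for $g$ monic of degree $n-k$ it is $A$-free of rank $k$. The dual is $\mathcal{C}^\perp=\{y\in A^n:\sum_i x_iy_i=0\text{ for all }x\in\mathcal{C}\}$. A matrix $H\in M_{n,t}(A)$, $t\le n$, is a control matrix of $\mathcal{C}$ if $\mathcal{C}=\{x\in A^n:xH=0\}$. A generating matrix of a free submodule of $A^n$ is a matrix whose rows form a basis of it. For an $A$-free code $\mathcal{C}$ of length $n$ and rank $k$, a matrix $H_*\in M_{n-k,n}(A)$ is a parity-check matrix of $\mathcal{C}$ if $H_*^T$ is a control matrix of $\mathcal{C}$ and $H_*$ is a generating matrix of $\mathcal{C}^\perp$. *)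

theory Defs
  imports
    "HOL-Computational_Algebra.Polynomial"
    "HOL-Library.Set_Algebras"
    "Jordan_Normal_Form.VS_Connect"
begin

text \<open>
  Elements of the skew-polynomial ring \<open>A[X;\<sigma>]\<close> are represented by the type \<open>'a poly\<close>, with
  its usual addition and coefficients written on the left. Only the multiplication differs: it is
  \<open>skew_mult\<close> below and not the operation \<open>*\<close> of \<open>'a poly\<close>.
\<close>

definition skew_mult :: "('a::comm_ring_1 \<Rightarrow> 'a) \<Rightarrow> 'a poly \<Rightarrow> 'a poly \<Rightarrow> 'a poly" where
  "skew_mult \<sigma> p q =
     (\<Sum>i\<le>degree p. \<Sum>j\<le>degree q. monom (coeff p i * (\<sigma> ^^ i) (coeff q j)) (i + j))"

context
  fixes \<sigma> :: "'a::comm_ring_1 \<Rightarrow> 'a"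
  assumes hom: "comm_ring_hom \<sigma>"
begin

interpretation comm_ring_hom \<sigma> by (rule hom)

lemma funpow_ring_hom:
  "(\<sigma> ^^ i) 0 = 0" "(\<sigma> ^^ i) 1 = 1"
  "(\<sigma> ^^ i) (x + y) = (\<sigma> ^^ i) x + (\<sigma> ^^ i) y"
  "(\<sigma> ^^ i) (x * y) = (\<sigma> ^^ i) x * (\<sigma> ^^ i) y"
  by (induction i) (simp_all add: hom_distribs)

lemma skew_mult_extend:
  assumes "degree p \<le> m" "degree q \<le> n"
  shows "skew_mult \<sigma> p q =
    (\<Sum>i\<le>m. \<Sum>j\<le>n. monom (coeff p i * (\<sigma> ^^ i) (coeff q j)) (i + j))"
proof -
  have "(\<Sum>i\<le>m. \<Sum>j\<le>n. monom (coeff p i * (\<sigma> ^^ i) (coeff q j)) (i + j))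
      = (\<Sum>i\<le>m. \<Sum>j\<le>degree q. monom (coeff p i * (\<sigma> ^^ i) (coeff q j)) (i + j))"
    using assms(2)
    by (intro sum.cong refl sum.mono_neutral_right) (auto simp: coeff_eq_0 funpow_ring_hom)
  also have "\<dots> = skew_mult \<sigma> p q"
    unfolding skew_mult_def using assms(1)
    by (intro sum.mono_neutral_right) (auto simp: coeff_eq_0)
  finally show ?thesis by simp
qed

lemma skew_mult_add_left: "skew_mult \<sigma> (p + p') q = skew_mult \<sigma> p q + skew_mult \<sigma> p' q"
proof -
  let ?m = "max (degree p) (degree p')"
  have "degree (p + p') \<le> ?m" by (rule degree_add_le) auto
  then show ?thesis
    by (simp add: skew_mult_extend[where m = ?m and n = "degree q"] sum.distrib algebra_simps
        flip: add_monom)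
qed

lemma skew_mult_add_right: "skew_mult \<sigma> p (q + q') = skew_mult \<sigma> p q + skew_mult \<sigma> p q'"
proof -
  let ?n = "max (degree q) (degree q')"
  have "degree (q + q') \<le> ?n" by (rule degree_add_le) auto
  then show ?thesis
    by (simp add: skew_mult_extend[where n = ?n and m = "degree p"] sum.distrib algebra_simps
        funpow_ring_hom flip: add_monom)
qed

lemma skew_mult_monom:
  "skew_mult \<sigma> (monom x i) (monom y j) = monom (x * (\<sigma> ^^ i) y) (i + j)"
proof -
  have "skew_mult \<sigma> (monom x i) (monom y j) =
     (\<Sum>k\<le>i. \<Sum>l\<le>j. monom (coeff (monom x i) k * (\<sigma> ^^ k) (coeff (monom y j) l)) (k + l))"
    by (rule skew_mult_extend) (auto simp: degree_monom_le)
  also have "\<dots> = (\<Sum>k\<in>{i}. \<Sum>l\<le>j. monom (coeff (monom x i) k * (\<sigma> ^^ k) (coeff (monom y j) l)) (k + l))"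
    by (rule sum.mono_neutral_right) (auto simp: funpow_ring_hom)
  also have "\<dots> = (\<Sum>l\<in>{j}. monom (coeff (monom x i) i * (\<sigma> ^^ i) (coeff (monom y j) l)) (i + l))"
    by (subst sum.mono_neutral_right[where S = "{j}" and T = "{..j}", symmetric])
      (auto simp: funpow_ring_hom)
  finally show ?thesis by simp
qed

lemma skew_mult_X_const: "skew_mult \<sigma> (monom 1 1) [:x:] = skew_mult \<sigma> [:\<sigma> x:] (monom 1 1)"
  using skew_mult_monom[of 1 1 x 0] skew_mult_monom[of "\<sigma> x" 0 1 1] by (simp add: monom_0)

lemma skew_mult_zero [simp]: "skew_mult \<sigma> 0 q = 0" "skew_mult \<sigma> p 0 = 0"
  by (simp_all add: skew_mult_def funpow_ring_hom)

lemma poly_monom_induct [case_names zero add]: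
  assumes "P 0" "\<And>c i p. P p \<Longrightarrow> P (monom c i + p)"
  shows "P (p :: 'a poly)"
proof -
  have "P (\<Sum>i\<in>I. monom (coeff p i) i)" if "finite I" for I
    using that by induction (simp_all add: assms)
  from this[of "{..degree p}"] show ?thesis by (simp add: poly_as_sum_of_monoms)
qed

lemma skew_mult_one: "skew_mult \<sigma> 1 p = p" "skew_mult \<sigma> p 1 = p"
proof -
  show "skew_mult \<sigma> 1 p = p"
    by (induction p rule: poly_monom_induct)
      (simp_all add: skew_mult_add_right skew_mult_monom flip: monom_eq_1)
  show "skew_mult \<sigma> p 1 = p"
    by (induction p rule: poly_monom_induct)
      (simp_all add: skew_mult_add_left skew_mult_monom funpow_ring_hom flip: monom_eq_1)
qed

lemma skew_mult_assoc:
  "skew_mult \<sigma> (skew_mult \<sigma> p q) r = skew_mult \<sigma> p (skew_mult \<sigma> q r)"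
proof (induction p rule: poly_monom_induct)
  case (add a i p)
  have "skew_mult \<sigma> (skew_mult \<sigma> (monom a i) q) r = skew_mult \<sigma> (monom a i) (skew_mult \<sigma> q r)"
  proof (induction q rule: poly_monom_induct)
    case (add b j q)
    have "skew_mult \<sigma> (skew_mult \<sigma> (monom a i) (monom b j)) r
        = skew_mult \<sigma> (monom a i) (skew_mult \<sigma> (monom b j) r)"
      by (induction r rule: poly_monom_induct)
        (simp_all add: skew_mult_add_right skew_mult_monom funpow_ring_hom funpow_add algebra_simps)
    with add show ?case by (simp add: skew_mult_add_left skew_mult_add_right)
  qed simp
  with add show ?case by (simp add: skew_mult_add_left)
qed simp

end

definition skew_right_dvd :: "('a::comm_ring_1 \<Rightarrow> 'a) \<Rightarrow> 'a poly \<Rightarrow> 'a poly \<Rightarrow> bool" where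
  "skew_right_dvd \<sigma> g f \<longleftrightarrow> (\<exists>q. f = skew_mult \<sigma> q g)"

definition left_ideal_gen :: "('a::comm_ring_1 \<Rightarrow> 'a) \<Rightarrow> 'a poly \<Rightarrow> 'a poly set" where
  "left_ideal_gen \<sigma> p = {skew_mult \<sigma> q p | q. True}"

text \<open>
  \<open>p +o I\<close> is the coset of \<open>p\<close> modulo \<open>I\<close>, so the second conjunct is membership of a residue
  class in \<open>(g)\<^sub>l / (X\<^sup>n - a)\<^sub>l\<close>.
\<close>

definition constacyclic_code ::
    "('a::comm_ring_1 \<Rightarrow> 'a) \<Rightarrow> nat \<Rightarrow> 'a \<Rightarrow> 'a poly \<Rightarrow> 'a vec set" where
  "constacyclic_code \<sigma> n a g =
     (let I = left_ideal_gen \<sigma> (monom 1 n - [:a:])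
      in {d \<in> carrier_vec n.
            (\<Sum>i<n. monom (d $ i) i) +o I \<in> (\<lambda>q. q +o I) ` left_ideal_gen \<sigma> g})"

definition dual_code :: "nat \<Rightarrow> 'a::comm_ring_1 vec set \<Rightarrow> 'a vec set" where
  "dual_code n C = {y \<in> carrier_vec n. \<forall>x\<in>C. x \<bullet> y = 0}"

definition control_matrix :: "nat \<Rightarrow> 'a::comm_ring_1 vec set \<Rightarrow> 'a mat \<Rightarrow> bool" where
  "control_matrix n C H \<longleftrightarrow>
     dim_row H = n \<and> dim_col H \<le> n \<and>
     C = {x \<in> carrier_vec n. mat_of_row x * H = 0\<^sub>m 1 (dim_col H)}"

text \<open>
  Linear independence in the library is a property of sets of vectors; \<open>distinct\<close> makes it
  a property of the family of rows.
\<close>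

definition generating_matrix :: "nat \<Rightarrow> 'a::comm_ring_1 vec set \<Rightarrow> 'a mat \<Rightarrow> bool" where
  "generating_matrix n C G \<longleftrightarrow>
     dim_col G = n \<and> distinct (rows G) \<and>
     LinearCombinations.module.lin_indpt class_ring (module_vec TYPE('a) n) (set (rows G)) \<and>
     LinearCombinations.module.span class_ring (module_vec TYPE('a) n) (set (rows G)) = C"

definition free_code :: "nat \<Rightarrow> nat \<Rightarrow> 'a::comm_ring_1 vec set \<Rightarrow> bool" where
  "free_code n k C \<longleftrightarrow> (\<exists>G \<in> carrier_mat k n. generating_matrix n C G)"

definition parity_check_matrix ::
    "nat \<Rightarrow> nat \<Rightarrow> 'a::comm_ring_1 vec set \<Rightarrow> 'a mat \<Rightarrow> bool" where
  "parity_check_matrix n k C H \<longleftrightarrow>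
     free_code n k C \<and> H \<in> carrier_mat (n - k) n \<and>
     control_matrix n C H\<^sup>T \<and> generating_matrix n (dual_code n C) H"

end

theory Submission
  imports Defs
begin

text \<open>
  The polynomial \<open>X\<^sup>n - a\<close> lies in the left ideal \<open>(g)\<^sub>l\<close>, so a word \<open>x\<close> belongs to the code exactly when
  its polynomial \<open>x(X)\<close> is a left multiple of \<open>g\<close> (\<open>constacyclic_code_iff\<close>). The factor \<open>h\<close> tests
  this. If \<open>x = q g\<close>, then \<open>q\<close> has degree below \<open>k\<close> because \<open>g\<close> is monic of degree \<open>n - k\<close>, and
  \<open>x h = q (g h) = q X\<^sup>n - q a\<close> has no term of degree \<open>k, \<dots>, n - 1\<close>. Conversely, divide on the right,
  \<open>x = q g + r\<close> with \<open>deg r < n - k\<close>. If \<open>x h\<close> has no terms of these degrees, neither has \<open>r h\<close>;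
  but for \<open>k < n\<close> comparison of the terms of degree \<open>n\<close> in \<open>g h = X\<^sup>n - a\<close> shows \<open>h\<^sub>k = 1\<close>, as \<open>\<sigma>\<close> is
  injective, so a nonzero \<open>r\<close> would give \<open>r h\<close> the nonzero coefficient \<open>lead_coeff r\<close> in
  degree \<open>deg r + k < n\<close>. This is \<open>left_multiple_iff_check\<close>. Since the coefficient of \<open>X\<^sup>t\<^sup>+\<^sup>k\<close> in \<open>x h\<close> is the product of \<open>x\<close> with row \<open>t\<close> of the matrix \<open>H\<close> in
  question, the transpose of \<open>H\<close> is a control matrix.

  It remains to see that the rows of \<open>H\<close> form a basis of the dual code. Triangularity
  replaces the dimension count that would suffice over a field. The first \<open>n - k\<close> columns of \<open>H\<close>
  form an upper unitriangular matrix with diagonal entries \<open>\<sigma>\<^sup>t(h\<^sub>k) = 1\<close>, and the last \<open>k\<close> columns of the generating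
  matrix with rows \<open>X\<^sup>i g\<close> form a lower unitriangular one, since \<open>g\<close> is monic. The first fact gives
  independence of the rows of \<open>H\<close> and lets one subtract from a dual word a combination of these rows
  that clears its first \<open>n - k\<close> entries. By the second fact, a dual word of this kind is zero
  (\<open>orthogonal_complement_spanned\<close>).
\<close>

section \<open>Generating matrices\<close>

text \<open>
  Independence and span of the set of rows, restated with coefficients indexed by row numbers. The
  independence hypothesis also forces the rows to be distinct: if two of them were equal, the
  coefficients \<open>1\<close> and \<open>- 1\<close> would give a nontrivial relation. So sums over the set of rows can be
  reindexed.
\<close>

lemma generating_matrixI:
  fixes G :: "'a::comm_ring_1 mat"
  assumes G: "G \<in> carrier_mat m n"
    and indep: "\<And>c. (\<And>j. j < n \<Longrightarrow> (\<Sum>t<m. c t * G $$ (t, j)) = 0) \<Longrightarrow> \<forall>t<m. c t = 0"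
    and C: "C \<subseteq> carrier_vec n"
    and span: "\<And>y. y \<in> carrier_vec n \<Longrightarrow>
      y \<in> C \<longleftrightarrow> (\<exists>c. \<forall>j<n. y $ j = (\<Sum>t<m. c t * G $$ (t, j)))"
  shows "generating_matrix n C G"
proof -
  interpret vec_module "TYPE('a)" n .
  have inj: "inj_on (row G) {..<m}"
  proof (rule inj_onI, rule ccontr)
    fix s t assume st: "s \<in> {..<m}" "t \<in> {..<m}" "row G s = row G t" "s \<noteq> t"
    let ?c = "\<lambda>u. (if u = s then 1 else 0) - (if u = t then 1 else 0) :: 'a"
    have "(\<Sum>u<m. ?c u * G $$ (u, j)) = 0" if "j < n" for j
    proof -
      have "(\<Sum>u<m. ?c u * G $$ (u, j)) = G $$ (s, j) - G $$ (t, j)"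
        using st(1,2) by (simp add: left_diff_distrib sum_subtractf if_distrib[of "\<lambda>x. x * _"] cong: if_cong)
      also have "\<dots> = row G s $ j - row G t $ j" using st(1,2) that G by simp
      finally show ?thesis using st(3) by simp
    qed
    from indep[OF this] st show False by auto
  qed
  have rows: "set (rows G) = row G ` {..<m}"
    using G by (auto simp: rows_def)
  have sub: "set (rows G) \<subseteq> carrier_vec n" using G by (auto simp: rows_def)
  have dist: "distinct (rows G)"
    using inj G by (simp add: rows_def distinct_map lessThan_atLeast0)
  have index: "lincomb b (set (rows G)) $ j = (\<Sum>t<m. b (row G t) * G $$ (t, j))"
    if "j < n" for b j
  proof -
    have "lincomb b (set (rows G)) $ j = (\<Sum>x\<in>set (rows G). (b x \<cdot>\<^sub>v x) $ j)"
      unfolding lincomb_def using that sub by (intro finsum_index) auto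
    also have "\<dots> = (\<Sum>t<m. (b (row G t) \<cdot>\<^sub>v row G t) $ j)"
      unfolding rows by (simp add: sum.reindex[OF inj])
    also have "\<dots> = (\<Sum>t<m. b (row G t) * G $$ (t, j))"
      using that G by (intro sum.cong) auto
    finally show ?thesis .
  qed
  have closed: "lincomb b (set (rows G)) \<in> carrier_vec n" for b
    using sub by (intro lincomb_closed) auto
  have "lin_indpt (set (rows G))"
  proof (rule finite_lin_indpt2)
    fix b assume z: "lincomb b (set (rows G)) = 0\<^sub>v n"
    have "\<forall>t<m. b (row G t) = 0"
      using index[of _ b] by (intro indep) (simp add: z)
    then show "\<forall>v\<in>set (rows G). b v = 0" unfolding rows by auto
  qed (use sub in auto)
  moreover have "span (set (rows G)) = C"
  proof -
    have "span (set (rows G)) = {lincomb b (set (rows G)) | b. True}"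
      using finite_span[of "set (rows G)"] sub by simp
    also have "\<dots> = C"
    proof (intro equalityI subsetI)
      fix y assume "y \<in> {lincomb b (set (rows G)) | b. True}"
      then obtain b where y: "y = lincomb b (set (rows G))" by auto
      have "\<exists>c. \<forall>j<n. y $ j = (\<Sum>t<m. c t * G $$ (t, j))"
        unfolding y by (intro exI[of _ "\<lambda>t. b (row G t)"]) (simp add: index)
      then show "y \<in> C" using span[of y] closed[of b] by (simp add: y)
    next
      fix y assume "y \<in> C"
      with C have yn: "y \<in> carrier_vec n" by auto
      with \<open>y \<in> C\<close> span obtain c where c: "\<forall>j<n. y $ j = (\<Sum>t<m. c t * G $$ (t, j))" by blast
      define b where "b = c \<circ> the_inv_into {..<m} (row G)"
      have b: "b (row G t) = c t" if "t < m" for t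
        using the_inv_into_f_f[OF inj] that by (simp add: b_def)
      have "y = lincomb b (set (rows G))"
        using yn closed[of b] by (intro eq_vecI) (auto simp: index b c)
      then show "y \<in> {lincomb b (set (rows G)) | b. True}" by auto
    qed
    finally show ?thesis .
  qed
  ultimately show ?thesis
    using G dist by (simp add: generating_matrix_def)
qed

section \<open>Unitriangular systems\<close>

text \<open>
  Forward substitution: row \<open>m\<close> contributes nothing to the equations before the one numbered \<open>m\<close>,
  so its coefficient can be chosen last, and the diagonal entry \<open>1\<close> makes that choice possible
  without division.
\<close>

lemma unitriangular_solvable:
  fixes M :: "nat \<Rightarrow> nat \<Rightarrow> 'a::comm_ring_1"
  assumes diag: "\<And>t. t < m \<Longrightarrow> M t t = 1" and lower: "\<And>t j. t < m \<Longrightarrow> j < t \<Longrightarrow> M t j = 0"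
  shows "\<exists>c. \<forall>j<m. (\<Sum>t<m. c t * M t j) = y j"
  using assms
proof (induction m)
  case (Suc m)
  then obtain c where c: "\<forall>j<m. (\<Sum>t<m. c t * M t j) = y j" by auto
  let ?c = "c(m := y m - (\<Sum>t<m. c t * M t m))"
  have "(\<Sum>t<Suc m. ?c t * M t j) = y j" if "j < Suc m" for j
  proof -
    have "(\<Sum>t<m. ?c t * M t j) = (\<Sum>t<m. c t * M t j)" by (intro sum.cong) auto
    with that c Suc.prems show ?thesis by (cases "j = m") auto
  qed
  then show ?case by blast
qed simp

lemma unitriangular_independent:
  fixes M :: "nat \<Rightarrow> nat \<Rightarrow> 'a::comm_ring_1"
  assumes diag: "\<And>t. t < m \<Longrightarrow> M t t = 1" and lower: "\<And>t j. t < m \<Longrightarrow> j < t \<Longrightarrow> M t j = 0"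
    and zero: "\<And>j. j < m \<Longrightarrow> (\<Sum>t<m. c t * M t j) = 0"
    and "t < m"
  shows "c t = 0"
  using \<open>t < m\<close>
proof (induction t rule: less_induct)
  case (less t)
  have "c u * M u t = (if u = t then c t else 0)" if "u < m" for u
    using less that diag lower by (cases u t rule: linorder_cases) auto
  then have "(\<Sum>u<m. c u * M u t) = c t"
    using less.prems by simp
  with zero less.prems show ?case by simp
qed

text \<open>
  Subtracting a combination of the rows of \<open>H\<close> from \<open>y\<close> clears the first \<open>m\<close> entries and preserves
  orthogonality to \<open>G\<close>. For the difference \<open>z\<close>, orthogonality to row \<open>i\<close> of \<open>G\<close> then involves only the
  entries \<open>m, \<dots>, m + i\<close>, and these vanish one after the other.
\<close>

lemma orthogonal_complement_spanned:
  fixes G H :: "nat \<Rightarrow> nat \<Rightarrow> 'a::comm_ring_1"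
  assumes H_diag: "\<And>t. t < m \<Longrightarrow> H t t = 1" and H_lower: "\<And>t j. t < m \<Longrightarrow> j < t \<Longrightarrow> H t j = 0"
    and G_diag: "\<And>i. i < k \<Longrightarrow> G i (m + i) = 1"
    and G_upper: "\<And>i j. i < k \<Longrightarrow> m + i < j \<Longrightarrow> G i j = 0"
    and GH: "\<And>i t. i < k \<Longrightarrow> t < m \<Longrightarrow> (\<Sum>j<m + k. G i j * H t j) = 0"
    and Gy: "\<And>i. i < k \<Longrightarrow> (\<Sum>j<m + k. G i j * y j) = 0"
  shows "\<exists>c. \<forall>j<m + k. y j = (\<Sum>t<m. c t * H t j)"
proof -
  obtain c where c: "\<forall>j<m. (\<Sum>t<m. c t * H t j) = y j"
    using unitriangular_solvable[of m H y] H_diag H_lower by blast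
  define z where "z j = y j - (\<Sum>t<m. c t * H t j)" for j
  have Gz: "(\<Sum>j<m + k. G i j * z j) = 0" if "i < k" for i
  proof -
    have "(\<Sum>j<m + k. G i j * (\<Sum>t<m. c t * H t j)) = (\<Sum>t<m. c t * (\<Sum>j<m + k. G i j * H t j))"
      unfolding sum_distrib_left by (subst sum.swap) (simp add: mult.left_commute)
    also have "\<dots> = 0" using GH that by simp
    finally show ?thesis
      using Gy that by (simp add: z_def right_diff_distrib sum_subtractf)
  qed
  have z_low: "z j = 0" if "j < m" for j using c that by (simp add: z_def)
  have z_high: "z (m + i) = 0" if "i < k" for i
    using that
  proof (induction i rule: less_induct)
    case (less i)
    have "G i j * z j = (if j = m + i then z (m + i) else 0)" if "j < m + k" for j
    proof (cases j "m + i" rule: linorder_cases)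
      case less': less
      show ?thesis
      proof (cases "j < m")
        case False
        with less' less.prems less.IH[of "j - m"] have "z j = 0" by auto
        with less' show ?thesis by simp
      qed (use z_low less' in simp)
    qed (use less.prems G_diag G_upper in auto)
    then have "(\<Sum>j<m + k. G i j * z j) = z (m + i)" using less.prems by simp
    with Gz[OF less.prems] show ?case by simp
  qed
  have "z j = 0" if "j < m + k" for j
    using z_low z_high[of "j - m"] that by (cases "j < m") auto
  then show ?thesis unfolding z_def by (intro exI[of _ c]) simp
qed

section \<open>Skew polynomials\<close>

definition codeword_poly :: "'a::comm_ring_1 vec \<Rightarrow> 'a poly" where
  "codeword_poly d = (\<Sum>i<dim_vec d. monom (d $ i) i)"

lemma coeff_codeword_poly: "coeff (codeword_poly d) i = (if i < dim_vec d then d $ i else 0)"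
  by (simp add: codeword_poly_def coeff_sum)

context
  fixes \<sigma> :: "'a::comm_ring_1 \<Rightarrow> 'a"
  assumes hom: "comm_ring_hom \<sigma>"
begin

lemmas funpow_hom [simp] = funpow_ring_hom[OF hom]

lemma coeff_skew_mult:
  "coeff (skew_mult \<sigma> p q) s = (\<Sum>i\<le>s. coeff p i * (\<sigma> ^^ i) (coeff q (s - i)))"
proof -
  let ?m = "max s (degree p)" and ?n = "max s (degree q)"
  have inner: "(\<Sum>j\<le>?n. coeff (monom (coeff p i * (\<sigma> ^^ i) (coeff q j)) (i + j)) s)
      = (if i \<le> s then coeff p i * (\<sigma> ^^ i) (coeff q (s - i)) else 0)" for i
  proof -
    have "(\<Sum>j\<le>?n. coeff (monom (coeff p i * (\<sigma> ^^ i) (coeff q j)) (i + j)) s)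
      = (\<Sum>j\<le>?n. if j = s - i then (if i \<le> s then coeff p i * (\<sigma> ^^ i) (coeff q (s - i)) else 0) else 0)"
      by (intro sum.cong) auto
    also have "\<dots> = (if i \<le> s then coeff p i * (\<sigma> ^^ i) (coeff q (s - i)) else 0)"
      by (subst sum.delta) auto
    finally show ?thesis .
  qed
  have "coeff (skew_mult \<sigma> p q) s
    = (\<Sum>i\<le>?m. \<Sum>j\<le>?n. coeff (monom (coeff p i * (\<sigma> ^^ i) (coeff q j)) (i + j)) s)"
    by (subst skew_mult_extend[OF hom, of p ?m q ?n]) (simp_all add: coeff_sum)
  also have "\<dots> = (\<Sum>i\<le>?m. if i \<le> s then coeff p i * (\<sigma> ^^ i) (coeff q (s - i)) else 0)"
    by (simp only: inner)
  also have "\<dots> = (\<Sum>i\<le>s. coeff p i * (\<sigma> ^^ i) (coeff q (s - i)))"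
    by (intro sum.mono_neutral_cong_right) auto
  finally show ?thesis .
qed

text \<open>
  Summing over a range independent of \<open>s\<close> exhibits multiplication by \<open>q\<close> as a matrix acting on the
  coefficients of \<open>p\<close> from the right.
\<close>

lemma coeff_skew_mult_bounded:
  assumes "\<And>i. i \<ge> m \<Longrightarrow> coeff p i = 0"
  shows "coeff (skew_mult \<sigma> p q) s
    = (\<Sum>i<m. coeff p i * (if i \<le> s then (\<sigma> ^^ i) (coeff q (s - i)) else 0))"
  unfolding coeff_skew_mult using assms
  by (intro sum.mono_neutral_cong) (auto simp: not_less)

lemma coeff_skew_mult_top:
  assumes "degree q \<le> m"
  shows "coeff (skew_mult \<sigma> p q) (degree p + m) = lead_coeff p * (\<sigma> ^^ degree p) (coeff q m)"
proof -
  have "coeff p i * (if i \<le> degree p + m then (\<sigma> ^^ i) (coeff q (degree p + m - i)) else 0) = 0"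
    if "i < degree p" for i
    using that assms by (simp add: coeff_eq_0)
  then show ?thesis
    by (simp add: coeff_skew_mult_bounded[of "Suc (degree p)" p] coeff_eq_0)
qed

text \<open>
  A monic right factor cannot lower degrees, even over a ring with zero divisors. The case \<open>k = 0\<close>
  says that right multiplication by \<open>g\<close> can be cancelled.
\<close>

lemma skew_quotient_bounded:
  assumes "lead_coeff g = 1" and "\<And>s. s \<ge> k + degree g \<Longrightarrow> coeff (skew_mult \<sigma> q g) s = 0"
    and "i \<ge> k"
  shows "coeff q i = 0"
proof (cases "q = 0")
  case False
  have "coeff (skew_mult \<sigma> q g) (degree q + degree g) \<noteq> 0"
    using coeff_skew_mult_top[of g "degree g" q] assms(1) False by simp
  with assms(2) have "degree q < k" by (meson add_le_mono1 not_le)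
  with assms(3) show ?thesis by (simp add: coeff_eq_0)
qed simp

lemma skew_right_division:
  assumes "lead_coeff g = 1"
  shows "\<exists>q r. p = skew_mult \<sigma> q g + r \<and> (\<forall>i\<ge>degree g. coeff r i = 0)"
proof -
  have "\<exists>q r. p = skew_mult \<sigma> q g + r \<and> (\<forall>i\<ge>degree g. coeff r i = 0)"
    if "\<forall>i\<ge>degree g + m. coeff p i = 0" for m p
    using that
  proof (induction m arbitrary: p)
    case 0
    then show ?case by (intro exI[of _ 0] exI[of _ p]) (simp add: skew_mult_zero[OF hom])
  next
    case (Suc m)
    \<comment> \<open>\<open>u g\<close> has the same coefficient as \<open>p\<close> at \<open>X\<^sup>d\<^sup>+\<^sup>m\<close>, where \<open>d = deg g\<close>, since \<open>\<sigma>\<^sup>m(1) = 1\<close>\<close>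
    define u where "u = monom (coeff p (degree g + m)) m"
    have u0: "coeff u i = 0" if "i \<ge> Suc m" for i using that by (simp add: u_def)
    have "\<forall>i\<ge>degree g + m. coeff (p - skew_mult \<sigma> u g) i = 0"
    proof (intro allI impI)
      fix i assume i: "degree g + m \<le> i"
      have "coeff (skew_mult \<sigma> u g) i = coeff u m * (\<sigma> ^^ m) (coeff g (i - m))"
        by (subst coeff_skew_mult_bounded[OF u0])
          (use i in \<open>auto simp: u_def if_distrib[of "\<lambda>x. x * _"] cong: if_cong\<close>)
      with i Suc.prems assms show "coeff (p - skew_mult \<sigma> u g) i = 0"
        by (cases "i = degree g + m") (auto simp: u_def coeff_eq_0)
    qed
    from Suc.IH[OF this] obtain q r where
      "p - skew_mult \<sigma> u g = skew_mult \<sigma> q g + r" "\<forall>i\<ge>degree g. coeff r i = 0" by blast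
    then show ?case
      by (intro exI[of _ "q + u"] exI[of _ r])
        (simp add: skew_mult_add_left[OF hom] algebra_simps)
  qed
  from this[of "Suc (degree p)" p] show ?thesis by (auto simp: coeff_eq_0)
qed

section \<open>The code and its check polynomial\<close>

text \<open>
  The quotient disappears because \<open>(X\<^sup>n - a)\<^sub>l \<subseteq> (g)\<^sub>l\<close>: a coset of the smaller ideal that contains
  one element of the larger one lies inside it.
\<close>

lemma constacyclic_code_iff:
  assumes "skew_right_dvd \<sigma> g (monom 1 n - [:a:])"
  shows "d \<in> constacyclic_code \<sigma> n a g
    \<longleftrightarrow> d \<in> carrier_vec n \<and> (\<exists>q. codeword_poly d = skew_mult \<sigma> q g)"
proof -
  let ?I = "left_ideal_gen \<sigma> (monom 1 n - [:a:])" and ?J = "left_ideal_gen \<sigma> g"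
  obtain u where u: "monom 1 n - [:a:] = skew_mult \<sigma> u g"
    using assms by (auto simp: skew_right_dvd_def)
  have zero: "0 \<in> ?I"
    unfolding left_ideal_gen_def using skew_mult_zero(1)[OF hom] by (metis (mono_tags, lifting) mem_Collect_eq)
  have "x +o ?I \<in> (\<lambda>q. q +o ?I) ` ?J \<longleftrightarrow> x \<in> ?J" for x
  proof
    assume "x +o ?I \<in> (\<lambda>q. q +o ?I) ` ?J"
    then obtain q where q: "q \<in> ?J" "x +o ?I = q +o ?I" by auto
    have "x \<in> x +o ?I" using zero by (force simp: elt_set_plus_def)
    with q(2) obtain v where "x = q + skew_mult \<sigma> v (monom 1 n - [:a:])"
      by (auto simp: elt_set_plus_def left_ideal_gen_def)
    then have "x = q + skew_mult \<sigma> (skew_mult \<sigma> v u) g"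
      by (simp add: u skew_mult_assoc[OF hom])
    with q(1) show "x \<in> ?J"
      by (auto simp: left_ideal_gen_def simp flip: skew_mult_add_left[OF hom])
  qed auto
  then show ?thesis
    by (auto simp: constacyclic_code_def Let_def codeword_poly_def left_ideal_gen_def)
qed

text \<open>
  A left multiple \<open>q g\<close> of degree below \<open>n\<close> satisfies \<open>q g h = q X\<^sup>n - q a\<close> with \<open>deg q < k\<close>, which leaves
  a gap in degrees \<open>k, \<dots>, n - 1\<close>. The remainder of \<open>x\<close> on division by \<open>g\<close> must therefore pass
  the same test, and the leading term of its product with \<open>h\<close> falls into the gap. The condition on the coefficient
  of \<open>X\<^sup>k\<close> in \<open>h\<close> is restricted to \<open>k < n\<close> because for \<open>n = 0\<close> that coefficient is \<open>1 - a\<close>.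
\<close>

lemma left_multiple_iff_check:
  assumes "k \<le> n" and g: "lead_coeff g = 1" "degree g = n - k"
    and h: "degree h \<le> k" and gh: "monom 1 n - [:a:] = skew_mult \<sigma> g h"
    and top: "k < n \<Longrightarrow> coeff h k = 1"
    and x: "\<And>s. s \<ge> n \<Longrightarrow> coeff x s = 0"
  shows "(\<exists>q. x = skew_mult \<sigma> q g) \<longleftrightarrow> (\<forall>t<n - k. coeff (skew_mult \<sigma> x h) (t + k) = 0)"
proof
  have *: "coeff (skew_mult \<sigma> (skew_mult \<sigma> q g) h) (t + k) = 0"
    if q: "\<And>s. s \<ge> n \<Longrightarrow> coeff (skew_mult \<sigma> q g) s = 0" and t: "t < n - k" for q t
  proof -
    have q0: "coeff q i = 0" if "i \<ge> k" for i
      using skew_quotient_bounded[of g k q i] g q \<open>k \<le> n\<close> that by simp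
    have "skew_mult \<sigma> (skew_mult \<sigma> q g) h = skew_mult \<sigma> q (monom 1 n - [:a:])"
      by (simp add: gh skew_mult_assoc[OF hom])
    moreover have "coeff (skew_mult \<sigma> q (monom 1 n - [:a:])) (t + k) = 0"
      unfolding coeff_skew_mult
    proof (intro sum.neutral ballI)
      fix i
      show "coeff q i * (\<sigma> ^^ i) (coeff (monom 1 n - [:a:]) (t + k - i)) = 0"
      proof (cases "i < k")
        case True
        with t have "coeff (monom 1 n - [:a:]) (t + k - i) = 0"
          by (auto simp: coeff_pCons split: nat.splits)
        then show ?thesis by simp
      qed (simp add: q0)
    qed
    ultimately show ?thesis by simp
  qed
  show "\<forall>t<n - k. coeff (skew_mult \<sigma> x h) (t + k) = 0" if "\<exists>q. x = skew_mult \<sigma> q g"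
    using that * x by blast
  assume check: "\<forall>t<n - k. coeff (skew_mult \<sigma> x h) (t + k) = 0"
  obtain q r where xqr: "x = skew_mult \<sigma> q g + r" and r: "\<forall>i\<ge>degree g. coeff r i = 0"
    using skew_right_division[OF g(1)] by blast
  have "coeff (skew_mult \<sigma> q g) s = 0" if "s \<ge> n" for s
    using x[OF that] r that g(2) by (simp add: xqr)
  with * check have rh: "coeff (skew_mult \<sigma> r h) (t + k) = 0" if "t < n - k" for t
    using that by (simp add: xqr skew_mult_add_left[OF hom])
  have "r = 0"
  proof (rule ccontr)
    assume "r \<noteq> 0"
    with r g(2) have "degree r < n - k" by (metis leading_coeff_0_iff not_le)
    moreover from this have "coeff (skew_mult \<sigma> r h) (degree r + k) = lead_coeff r"
      using coeff_skew_mult_top[OF h, of r] top by simp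
    ultimately show False using rh \<open>r \<noteq> 0\<close> by simp
  qed
  with xqr show "\<exists>q. x = skew_mult \<sigma> q g" by auto
qed

end

theorem corollary6p3:
  fixes \<sigma> :: "'a::{finite, comm_ring_1} \<Rightarrow> 'a"
    and a :: 'a and g h :: "'a poly" and n k :: nat
  assumes "comm_ring_hom \<sigma>" and "bij \<sigma>"
    and "a dvd 1"
    and "k \<le> n"
    and "lead_coeff g = 1" and "degree g = n - k"
    and "skew_right_dvd \<sigma> g (monom 1 n - [:a:])"
    and "degree h \<le> k"
    and "monom 1 n - [:a:] = skew_mult \<sigma> g h"
  shows "parity_check_matrix n k (constacyclic_code \<sigma> n a g)
           (mat (n - k) n (\<lambda>(t, j).
              if t \<le> j \<and> j \<le> t + k then (\<sigma> ^^ j) (coeff h (t + k - j)) else 0))"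
proof -
  note hom = assms(1) and g = assms(5,6) and h = assms(8)
  let ?C = "constacyclic_code \<sigma> n a g"
  define hr where "hr t j = (if t \<le> j \<and> j \<le> t + k then (\<sigma> ^^ j) (coeff h (t + k - j)) else 0)" for t j
  \<comment> \<open>row \<open>i\<close> of \<open>gr\<close> is the coefficient vector of \<open>X\<^sup>i g\<close>\<close>
  define gr where "gr i j = (if i \<le> j then (\<sigma> ^^ i) (coeff g (j - i)) else 0)" for i j
  define H where "H = mat (n - k) n (\<lambda>(t, j). hr t j)"
  define G where "G = mat k n (\<lambda>(i, j). gr i j)"
  have C_carrier: "?C \<subseteq> carrier_vec n"
    using constacyclic_code_iff[OF hom assms(7)] by blast

  \<comment> \<open>comparing coefficients at \<open>X\<^sup>n\<close> in \<open>g h = X\<^sup>n - a\<close> gives only \<open>\<sigma>\<^sup>n\<^sup>-\<^sup>k(h\<^sub>k) = 1\<close>; injectivity of \<open>\<sigma>\<close> removes the twist\<close>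
  have top: "coeff h k = 1" if "k < n"
  proof -
    have "(\<sigma> ^^ (n - k)) (coeff h k) = coeff (monom 1 n - [:a:]) n"
      using coeff_skew_mult_top[OF hom h, of g] g \<open>k \<le> n\<close> by (simp add: assms(9))
    also have "\<dots> = (\<sigma> ^^ (n - k)) 1"
      using that by (auto simp: funpow_ring_hom[OF hom] coeff_pCons split: nat.splits)
    finally show ?thesis
      using bij_is_inj[OF bij_fn[OF \<open>bij \<sigma>\<close>, of "n - k"]] by (simp add: inj_eq)
  qed
  have hr_diag: "hr t t = 1" if "t < n - k" for t
    using that top by (simp add: hr_def funpow_ring_hom[OF hom])
  have hr_lower: "hr t j = 0" if "j < t" for t j
    using that by (simp add: hr_def)
  have gr_diag: "gr i (n - k + i) = 1" for i
    using g by (simp add: gr_def funpow_ring_hom[OF hom])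
  have gr_upper: "gr i j = 0" if "n - k + i < j" for i j
    using that g by (simp add: gr_def coeff_eq_0 funpow_ring_hom[OF hom])

  have syndrome: "(\<Sum>j<n. x $ j * hr t j) = coeff (skew_mult \<sigma> (codeword_poly x) h) (t + k)"
    if "x \<in> carrier_vec n" for x t
    using that h
    by (subst coeff_skew_mult_bounded[OF hom, of n])
      (auto simp: coeff_codeword_poly hr_def coeff_eq_0 funpow_ring_hom[OF hom] intro!: sum.cong)
  have C_iff: "x \<in> ?C \<longleftrightarrow> (\<forall>t<n - k. (\<Sum>j<n. x $ j * hr t j) = 0)"
    if "x \<in> carrier_vec n" for x
    using that constacyclic_code_iff[OF hom assms(7)] syndrome[OF that]
      left_multiple_iff_check[OF hom \<open>k \<le> n\<close> g h assms(9) top, of "codeword_poly x"]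
    by (simp add: coeff_codeword_poly)

  have encode: "(\<Sum>i<k. c i * gr i j) = coeff (skew_mult \<sigma> (\<Sum>i<k. monom (c i) i) g) j" for c j
    by (subst coeff_skew_mult_bounded[OF hom, of k])
      (auto simp: coeff_sum gr_def intro!: sum.cong)
  have C_span: "x \<in> ?C \<longleftrightarrow> (\<exists>c. \<forall>j<n. x $ j = (\<Sum>i<k. c i * gr i j))"
    if x: "x \<in> carrier_vec n" for x
  proof
    assume "x \<in> ?C"
    then obtain q where q: "codeword_poly x = skew_mult \<sigma> q g"
      using constacyclic_code_iff[OF hom assms(7)] by blast
    have "coeff q i = 0" if "i \<ge> k" for i
      using skew_quotient_bounded[OF hom g(1), of k q i] that g(2) \<open>k \<le> n\<close> x
      by (simp add: coeff_codeword_poly flip: q)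
    then have "x $ j = (\<Sum>i<k. coeff q i * gr i j)" if "j < n" for j
      using that x coeff_skew_mult_bounded[OF hom, of k q g j]
      by (auto simp: gr_def coeff_codeword_poly simp flip: q)
    then show "\<exists>c. \<forall>j<n. x $ j = (\<Sum>i<k. c i * gr i j)" by blast
  next
    assume "\<exists>c. \<forall>j<n. x $ j = (\<Sum>i<k. c i * gr i j)"
    then obtain c where c: "\<And>j. j < n \<Longrightarrow> x $ j = (\<Sum>i<k. c i * gr i j)" by blast
    have "codeword_poly x = skew_mult \<sigma> (\<Sum>i<k. monom (c i) i) g"
    proof (rule poly_eqI)
      fix j
      have "(\<Sum>i<k. c i * gr i j) = 0" if "j \<ge> n"
        using that gr_upper \<open>k \<le> n\<close> by (intro sum.neutral) simp
      then show "coeff (codeword_poly x) j = coeff (skew_mult \<sigma> (\<Sum>i<k. monom (c i) i) g) j"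
        using x c by (simp add: coeff_codeword_poly flip: encode)
    qed
    with x show "x \<in> ?C" using constacyclic_code_iff[OF hom assms(7)] by blast
  qed

  have "generating_matrix n ?C G"
  proof (rule generating_matrixI[where m = k])
    fix c assume z: "\<And>j. j < n \<Longrightarrow> (\<Sum>t<k. c t * G $$ (t, j)) = 0"
    have "coeff (skew_mult \<sigma> (\<Sum>i<k. monom (c i) i) g) s = 0" for s
    proof (cases "s < n")
      case True
      with z[OF True] show ?thesis by (simp add: G_def flip: encode)
    next
      case False
      then show ?thesis using gr_upper \<open>k \<le> n\<close> unfolding encode[symmetric]
        by (intro sum.neutral) simp
    qed
    then have "coeff (\<Sum>i<k. monom (c i) i) t = 0" for t
      by (rule skew_quotient_bounded[OF hom g(1), of 0]) auto
    then have "(if t < k then c t else 0) = 0" for t by (simp add: coeff_sum)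
    then show "\<forall>t<k. c t = 0" by meson
  qed (use C_carrier C_span in \<open>simp_all add: G_def\<close>)
  then have free: "free_code n k ?C" by (auto simp: free_code_def G_def)

  have H: "H \<in> carrier_mat (n - k) n" by (simp add: H_def)
  have "control_matrix n ?C H\<^sup>T"
  proof -
    have "mat_of_row x * H\<^sup>T = 0\<^sub>m 1 (n - k) \<longleftrightarrow> (\<forall>t<n - k. (\<Sum>j<n. x $ j * hr t j) = 0)"
      if "x \<in> carrier_vec n" for x
      using that by (auto simp: mat_eq_iff H_def scalar_prod_def lessThan_atLeast0)
    then have "?C = {x \<in> carrier_vec n. mat_of_row x * H\<^sup>T = 0\<^sub>m 1 (n - k)}"
      using C_iff C_carrier by blast
    then show ?thesis using H by (simp add: control_matrix_def)
  qed
  moreover have "generating_matrix n (dual_code n ?C) H"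
  proof (rule generating_matrixI[OF H])
    fix c assume z: "\<And>j. j < n \<Longrightarrow> (\<Sum>t<n - k. c t * H $$ (t, j)) = 0"
    have "(\<Sum>t<n - k. c t * hr t j) = 0" if "j < n - k" for j
      using z[of j] that by (simp add: H_def)
    then show "\<forall>t<n - k. c t = 0"
      using unitriangular_independent[of "n - k" hr c] hr_diag hr_lower by blast
  next
    fix y :: "'a vec" assume y: "y \<in> carrier_vec n"
    have prod: "x \<bullet> y = (\<Sum>j<n. x $ j * y $ j)" for x
      using y by (simp add: scalar_prod_def lessThan_atLeast0)
    have "y \<in> dual_code n ?C \<longleftrightarrow> (\<exists>c. \<forall>j<n. y $ j = (\<Sum>t<n - k. c t * hr t j))"
    proof
      assume "y \<in> dual_code n ?C"
      then have dual: "(\<Sum>j<n. x $ j * y $ j) = 0" if "x \<in> ?C" for x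
        using that prod by (simp add: dual_code_def)
      \<comment> \<open>row \<open>i\<close> of \<open>G\<close> is the encoding of the \<open>i\<close>-th unit vector\<close>
      have row: "vec n (gr i) \<in> ?C" if "i < k" for i
        using that
        by (subst C_span) (auto intro!: exI[of _ "\<lambda>l. if l = i then 1 else 0"]
            simp: if_distrib[of "\<lambda>x. x * _"] cong: if_cong)
      have "\<exists>c. \<forall>j<n - k + k. y $ j = (\<Sum>t<n - k. c t * hr t j)"
      proof (rule orthogonal_complement_spanned[where G = gr])
        show "(\<Sum>j<n - k + k. gr i j * hr t j) = 0" if "i < k" "t < n - k" for i t
          using C_iff[of "vec n (gr i)"] row[OF that(1)] that(2) \<open>k \<le> n\<close> by simp
        show "(\<Sum>j<n - k + k. gr i j * y $ j) = 0" if "i < k" for i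
          using dual[OF row[OF that]] \<open>k \<le> n\<close> by simp
      qed (use hr_diag hr_lower gr_diag gr_upper in auto)
      then show "\<exists>c. \<forall>j<n. y $ j = (\<Sum>t<n - k. c t * hr t j)"
        using \<open>k \<le> n\<close> by simp
    next
      assume "\<exists>c. \<forall>j<n. y $ j = (\<Sum>t<n - k. c t * hr t j)"
      then obtain c where c: "\<And>j. j < n \<Longrightarrow> y $ j = (\<Sum>t<n - k. c t * hr t j)" by blast
      have "x \<bullet> y = 0" if "x \<in> ?C" for x
      proof -
        have "x \<bullet> y = (\<Sum>j<n. \<Sum>t<n - k. c t * (x $ j * hr t j))"
          by (simp add: prod c sum_distrib_left mult.left_commute)
        also have "\<dots> = (\<Sum>t<n - k. c t * (\<Sum>j<n. x $ j * hr t j))"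
          by (subst sum.swap) (simp add: sum_distrib_left)
        also have "\<dots> = 0" using C_iff that C_carrier by auto
        finally show ?thesis .
      qed
      with y show "y \<in> dual_code n ?C" by (simp add: dual_code_def)
    qed
    then show "y \<in> dual_code n ?C \<longleftrightarrow> (\<exists>c. \<forall>j<n. y $ j = (\<Sum>t<n - k. c t * H $$ (t, j)))"
      by (simp add: H_def)
  qed (auto simp: dual_code_def)
  ultimately have "parity_check_matrix n k ?C H"
    using free H by (simp add: parity_check_matrix_def)
  then show ?thesis unfolding H_def hr_def .
qed

end
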